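(* Assume $c_I<c_F$. Let $$A(s):=(v-c_F^+)F(s-\overline p_F)+c_F^+F(s),$$ $$B(s):=c_F+(v-c_F^+)F(s-\overline p_F)-c_F^-(1-F(s)),$$ $$C(s):=(v-c_F^-)F(s-\overline p_F)+c_F^-F(s),$$ $$l_1:=F^{-1}\left(\frac{c_F-c_F^-}{c_F^+-c_F^-}\right),\qquad l_2:=\min\{l\ge0:\ A(l)\ge c_I\},$$ and, when $l_1<l_2$, let $l_8$ be defined as the value $x$ with $l_1+\overline p_I\le x\le l_2+\overline p_I$ and $$c_I\left(\overline p_I-\max(x-l_2,0)\right)-\int_{\min(x-\overline p_I,\,l_1)}^{\min(x-\overline p_I,\,l_1+\overline p_F)}(A(s)-B(s))\,ds-\int_{\min(x-\overline p_I,\,l_1+\overline p_F)}^{x-\overline p_I}(A(s)-C(s))\,ds-\int_{x-\overline p_I}^{\min(x,\,l_2)}A(s)\,ds=0.$$ Then, for every load $l\ge 0$ for which (BL) is feasible, the forward part $(p_W,p_I,p_F)$ of the solution to the bilevel problem (BL) is given by the following rule. If $l_1\ge l_2$: 1. $(l,\,0,\,0)$ if $0\le l\le l_2$; 2. $(l_2,\,l-l_2,\,0)$ if $l_2\le l\le\overline p_I+l_2$; 3. $(l-\overline p_I,\,\overline p_I,\,0)$ if $\overline p_I+l_2\le l\le\overline p_I+l_1$; 4. $(l_1,\,\overline p_I,\,l-\overline p_I-l_1)$ if $\overline p_I+l_1\le l\le\overline p_I+\overline p_F+l_1$; 5. $(l-\overline p_I-\overline p_F,\,\overline p_I,\,\overline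 p_F)$ if $\overline p_I+\overline p_F+l_1\le l$. If $l_1<l_2$: 6. $(l,\,0,\,0)$ if $0\le l\le\min(l_2,l_8)$; 7. $(l_2,\,l-l_2,\,0)$ if $l_2\le l\le l_8$; 8. $(l_1,\,\overline p_I,\,l-\overline p_I-l_1)$ if $l_8\le l\le\overline p_I+\overline p_F+l_1$; 9. $(l-\overline p_I-\overline p_F,\,\overline p_I,\,\overline p_F)$ if $\max(l_8,\overline p_I+\overline p_F+l_1)\le l$.
   Context: Stylized power system: transmission capacity is infinite; there are inflexible, flexible and stochastic generation technologies with capacities $\overline p_I>0$, $\overline p_F>0$, $\overline p_W>0$. The marginal costs of inflexible and flexible generation are $c_I>0$ and $c_F>0$; the marginal cost of stochastic production is zero. $c_F^+$ is the unit cost of upward regulation by the flexible capacity, $c_F^-$ the unit utility it gets from downward regulation. Demand $l\ge 0$ is inelastic and known; $v$ is the unit cost of involuntary load curtailment. It holds that $v>c_F^+\ge c_F\ge c_F^-\ge 0$. It is assumed that $c_F^+>c_F^-$, so that $l_1$ is well defined. The stochastic production is a random variable $W$ on a probability space $(\Omega,\mathcal F,P)$ with values in $[0,\overline p_W]$, cumulative distribution function $F$ and density $f$; $W(\omega)$ is its realization and $\int_\Omega g(\omega)f(\omega)\,d\omega$ denotes the expectation of $g$. The generalized inverse is $F^{-1}(\alpha)=\inf\{x\in\mathbb R: F(x)\ge\alpha\}$, with $F^{-1}(0)$ understood as $\inf\{x: F(x)>0\}$. Bilevel problem (BL) (conventional two-stage market with centralized dispatch of stochastic production): minimize over $p_F,p_I,p_W$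 and $p_F^+(\omega),p_F^-(\omega),\Delta p_W(\omega),s(\omega)$ $$c_Ip_I+c_Fp_F+\int_\Omega\left(c_F^+p_F^+(\omega)-c_F^-p_F^-(\omega)+v\,s(\omega)\right)f(\omega)\,d\omega$$ subject to $0\le p_W\le\overline p_W$; for all $\omega\in\Omega$: $p_F^+(\omega)-p_F^-(\omega)+\Delta p_W(\omega)+s(\omega)=0$, $0\le p_F^+(\omega)\le\overline p_F-p_F$, $0\le p_F^-(\omega)\le p_F$, $0\le p_W+\Delta p_W(\omega)\le W(\omega)$, $0\le s(\omega)\le l$; and the lower-level condition $$(p_F,p_I)\in\arg\min_{x_F,x_I}\{c_Fx_F+c_Ix_I:\ x_F+x_I+p_W=l,\ 0\le x_F\le\overline p_F,\ 0\le x_I\le\overline p_I\}.$$ "The solution is given by" a rule means that the listed $(p_W,p_I,p_F)$ is the forward part of an optimal solution of (BL). *)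

theory Defs
  imports "HOL-Probability.Probability"
begin

text \<open>\<open>c_F_up\<close> is the unit cost of upward regulation, \<open>c_F_dn\<close> the unit utility of downward
  regulation and \<open>voll\<close> the unit cost of involuntary load curtailment.\<close>

record power_system =
  cap_I :: real
  cap_F :: real
  cap_W :: real
  c_I :: real
  c_F :: real
  c_F_up :: real
  c_F_dn :: real
  voll :: real

text \<open>The first three fields are the forward dispatch; the others are the real-time decisions
  \<open>p\<^sub>F\<^sup>+\<close>, \<open>p\<^sub>F\<^sup>-\<close>, \<open>\<Delta>p\<^sub>W\<close> and the load curtailment, as functions of the scenario.\<close>

record 'w decision =
  p_W :: real
  p_I :: real
  p_F :: real
  up :: "'w \<Rightarrow> real"
  dn :: "'w \<Rightarrow> real"
  dW :: "'w \<Rightarrow> real"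
  shed :: "'w \<Rightarrow> real"

definition lower_level_optimal :: "power_system \<Rightarrow> real \<Rightarrow> real \<Rightarrow> real \<Rightarrow> real \<Rightarrow> bool" where
  "lower_level_optimal S l pW pF pI \<longleftrightarrow>
     is_arg_min (\<lambda>(xF, xI). c_F S * xF + c_I S * xI)
       (\<lambda>(xF, xI). xF + xI + pW = l \<and> 0 \<le> xF \<and> xF \<le> cap_F S \<and> 0 \<le> xI \<and> xI \<le> cap_I S)
       (pF, pI)"

text \<open>Measurability of the real-time decisions is what gives the expected cost a meaning: they are
  bounded by the other constraints, hence integrable.\<close>

definition BL_feasible ::
  "power_system \<Rightarrow> 'w measure \<Rightarrow> ('w \<Rightarrow> real) \<Rightarrow> real \<Rightarrow> 'w decision \<Rightarrow> bool" where
  "BL_feasible S M W l x \<longleftrightarrow>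
     0 \<le> p_W x \<and> p_W x \<le> cap_W S \<and>
     up x \<in> borel_measurable M \<and> dn x \<in> borel_measurable M \<and>
     dW x \<in> borel_measurable M \<and> shed x \<in> borel_measurable M \<and>
     (\<forall>\<omega>\<in>space M.
        up x \<omega> - dn x \<omega> + dW x \<omega> + shed x \<omega> = 0 \<and>
        0 \<le> up x \<omega> \<and> up x \<omega> \<le> cap_F S - p_F x \<and>
        0 \<le> dn x \<omega> \<and> dn x \<omega> \<le> p_F x \<and>
        0 \<le> p_W x + dW x \<omega> \<and> p_W x + dW x \<omega> \<le> W \<omega> \<and>
        0 \<le> shed x \<omega> \<and> shed x \<omega> \<le> l) \<and>
     lower_level_optimal S l (p_W x) (p_F x) (p_I x)"

definition BL_cost :: "power_system \<Rightarrow> 'w measure \<Rightarrow> 'w decision \<Rightarrow> real" where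
  "BL_cost S M x = c_I S * p_I x + c_F S * p_F x +
     (\<integral>\<omega>. (c_F_up S * up x \<omega> - c_F_dn S * dn x \<omega> + voll S * shed x \<omega>) \<partial>M)"

definition BL_solution_forward ::
  "power_system \<Rightarrow> 'w measure \<Rightarrow> ('w \<Rightarrow> real) \<Rightarrow> real \<Rightarrow> real \<times> real \<times> real \<Rightarrow> bool" where
  "BL_solution_forward S M W l q \<longleftrightarrow>
     (\<exists>x. is_arg_min (BL_cost S M) (BL_feasible S M W l) x \<and> (p_W x, p_I x, p_F x) = q)"

text \<open>For a distribution function \<open>{x. F x \<ge> 0}\<close> is all of \<open>\<real>\<close> and has no infimum, so the value at
  \<open>0\<close> is fixed to be the infimum of \<open>{x. F x > 0}\<close>.\<close>

definition gen_inverse :: "(real \<Rightarrow> real) \<Rightarrow> real \<Rightarrow> real" where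
  "gen_inverse F \<alpha> = (if \<alpha> = 0 then Inf {x. F x > 0} else Inf {x. F x \<ge> \<alpha>})"

definition A_fun :: "power_system \<Rightarrow> (real \<Rightarrow> real) \<Rightarrow> real \<Rightarrow> real" where
  "A_fun S F s = (voll S - c_F_up S) * F (s - cap_F S) + c_F_up S * F s"

definition B_fun :: "power_system \<Rightarrow> (real \<Rightarrow> real) \<Rightarrow> real \<Rightarrow> real" where
  "B_fun S F s = c_F S + (voll S - c_F_up S) * F (s - cap_F S) - c_F_dn S * (1 - F s)"

definition C_fun :: "power_system \<Rightarrow> (real \<Rightarrow> real) \<Rightarrow> real \<Rightarrow> real" where
  "C_fun S F s = (voll S - c_F_dn S) * F (s - cap_F S) + c_F_dn S * F s"

definition load_1 :: "power_system \<Rightarrow> (real \<Rightarrow> real) \<Rightarrow> real" where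
  "load_1 S F = gen_inverse F ((c_F S - c_F_dn S) / (c_F_up S - c_F_dn S))"

definition load_2 :: "power_system \<Rightarrow> (real \<Rightarrow> real) \<Rightarrow> real" where
  "load_2 S F = (LEAST l. 0 \<le> l \<and> A_fun S F l \<ge> c_I S)"

text \<open>A predicate rather than a definite description: when \<open>F\<close> is constant on a long enough interval,
  the equation can have a whole interval of solutions.\<close>

definition is_load_8 :: "power_system \<Rightarrow> (real \<Rightarrow> real) \<Rightarrow> real \<Rightarrow> bool" where
  "is_load_8 S F x \<longleftrightarrow>
     (let l1 = load_1 S F; l2 = load_2 S F; k = x - cap_I S in
      l1 + cap_I S \<le> x \<and> x \<le> l2 + cap_I S \<and>
      c_I S * (cap_I S - max (x - l2) 0)
        - (LBINT s = ereal (min k l1)..ereal (min k (l1 + cap_F S)). A_fun S F s - B_fun S F s)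
        - (LBINT s = ereal (min k (l1 + cap_F S))..ereal k. A_fun S F s - C_fun S F s)
        - (LBINT s = ereal k..ereal (min x l2). A_fun S F s) = 0)"

end

theory Submission
  imports Defs
begin

text \<open>Since inflexible generation is cheaper, the lower level fills it first, so the forward
  dispatch is determined by the stochastic schedule \<open>p\<close>. With the optimal recourse inserted, the cost
  becomes a function of \<open>p\<close> that is convex on either side of the kink \<open>p = l - cap_I\<close>: on the right no
  flexible unit is committed and the slope is \<open>A(p) - c_I\<close>, which changes sign at \<open>l2\<close>; on the left
  the inflexible unit is full and the slope is
  \<open>(c_F_up - c_F_dn) F(p) - (c_F - c_F_dn)\<close>, which changes sign at \<open>l1\<close>.
  If \<open>l1 \<ge> l2\<close>, or if the kink lies outside \<open>(l1, l2)\<close>, the cost has one local minimum. Otherwise it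
  has two; the left-hand side of the equation for the load \<open>l8\<close> is exactly the difference of the two
  local minimal values, and it is decreasing in the load because on this range the optimal left value
  grows at rate \<open>B\<close> or \<open>C\<close>, hence at most \<open>A(l - cap_I)\<close>, which is at most the rate
  \<open>min (A(l)) c_I\<close> of the right value.\<close>

section \<open>The lower level as a merit-order condition\<close>

text \<open>Exchange argument: shifting output from the flexible to the cheaper inflexible unit
  saves money until one bound is hit. Conversely, a dispatch at such a bound uses the least flexible
  output compatible with the balance.\<close>

lemma lower_level_optimal_iff:
  assumes "c_I S < c_F S" "0 < cap_I S" "0 < cap_F S"
  shows "lower_level_optimal S l pW pF pI \<longleftrightarrow>
    pF + pI + pW = l \<and> 0 \<le> pF \<and> pF \<le> cap_F S \<and> 0 \<le> pI \<and> pI \<le> cap_I S \<and>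
    (pF = 0 \<or> pI = cap_I S)" (is "?L \<longleftrightarrow> ?R")
proof
  assume L: ?L
  then have feas: "pF + pI + pW = l" "0 \<le> pF" "pF \<le> cap_F S" "0 \<le> pI" "pI \<le> cap_I S"
    by (auto simp: lower_level_optimal_def is_arg_min_def)
  have "pF = 0 \<or> pI = cap_I S"
  proof (rule ccontr)
    assume neg: "\<not> (pF = 0 \<or> pI = cap_I S)"
    \<comment> \<open>The largest amount of output that can be shifted to the inflexible
      unit.\<close>
    define e where "e = min pF (cap_I S - pI)"
    have e: "0 < e" "e \<le> pF" "e \<le> cap_I S - pI"
      using neg feas by (auto simp: e_def)
    have "\<not> (c_F S * (pF - e) + c_I S * (pI + e) < c_F S * pF + c_I S * pI)"
      using L e feas by (auto simp: lower_level_optimal_def is_arg_min_def)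
    moreover have "c_I S * e < c_F S * e"
      using e assms by simp
    ultimately show False
      by (simp add: algebra_simps)
  qed
  with feas show ?R by blast
next
  assume R: ?R
  have "c_F S * pF + c_I S * pI \<le> c_F S * yF + c_I S * yI"
    if y: "yF + yI + pW = l" "0 \<le> yF" "yI \<le> cap_I S" for yF yI
  proof -
    have "pF \<le> yF" using R y by auto
    then have "c_I S * (yF - pF) \<le> c_F S * (yF - pF)"
      using assms by (intro mult_right_mono) auto
    moreover have yI: "yI = pI + pF - yF" using R y by auto
    ultimately show ?thesis unfolding yI by (simp add: algebra_simps)
  qed
  then show ?L
    using R by (fastforce simp: lower_level_optimal_def is_arg_min_def not_less)
qed

text \<open>An infimum controls a function only strictly to one side of it; continuity carries the
  bound to the threshold itself.\<close>

lemma isCont_le_from_left: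
  fixes g :: "real \<Rightarrow> real"
  assumes "isCont g t" "\<And>s. s < t \<Longrightarrow> g s \<le> c"
  shows "g t \<le> c"
proof (rule tendsto_upperbound)
  show "(g \<longlongrightarrow> g t) (at_left t)"
    using assms(1) by (metis continuous_within filterlim_at_split)
  show "\<forall>\<^sub>F s in at_left t. g s \<le> c"
    using assms(2) by (auto simp: eventually_at_filter)
qed simp

lemma isCont_ge_from_right:
  fixes g :: "real \<Rightarrow> real"
  assumes "isCont g t" "\<And>s. t < s \<Longrightarrow> c \<le> g s"
  shows "c \<le> g t"
proof (rule tendsto_lowerbound)
  show "(g \<longlongrightarrow> g t) (at_right t)"
    using assms(1) by (metis continuous_within filterlim_at_split)
  show "\<forall>\<^sub>F s in at_right t. c \<le> g s"
    using assms(2) by (auto simp: eventually_at_filter)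
qed simp

section \<open>The market model and the distribution of the stochastic production\<close>

locale two_stage_market = prob_space M
  for S :: power_system and M :: "'w measure" +
  fixes W :: "'w \<Rightarrow> real" and f :: "real \<Rightarrow> ennreal" and F :: "real \<Rightarrow> real"
    and l1 l2 :: real
  assumes density: "distributed M lborel W f"
    and W_range: "\<And>\<omega>. \<omega> \<in> space M \<Longrightarrow> 0 \<le> W \<omega> \<and> W \<omega> \<le> cap_W S"
    and F_def: "F = cdf (distr M borel W)"
    and cap_I_pos: "cap_I S > 0" and cap_F_pos: "cap_F S > 0" and cap_W_pos: "cap_W S > 0"
    and c_I_pos: "c_I S > 0" and c_F_pos: "c_F S > 0"
    and costs: "voll S > c_F_up S" "c_F_up S \<ge> c_F S" "c_F S \<ge> c_F_dn S" "c_F_dn S \<ge> 0"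
      "c_F_up S > c_F_dn S"
    and c_I_less: "c_I S < c_F S"
    and l1_def: "l1 = load_1 S F" and l2_def: "l2 = load_2 S F"
begin

text \<open>This is the antiderivative of \<open>F\<close> that vanishes for
  \<open>s \<le> 0\<close>. Every expected cost below is a combination of shifted copies of
  it.\<close>

definition shortfall :: "real \<Rightarrow> real" where
  "shortfall s = expectation (\<lambda>\<omega>. max 0 (s - W \<omega>))"

lemma W_measurable [measurable]: "W \<in> borel_measurable M"
  using distributed_measurable[OF density] by simp

lemma integrable_shortfall: "integrable M (\<lambda>\<omega>. max 0 (s - W \<omega>))"
proof (rule integrable_const_bound[where B = "\<bar>s\<bar>"])
  show "AE \<omega> in M. norm (max 0 (s - W \<omega>)) \<le> \<bar>s\<bar>"
    using W_range by (intro AE_I2) fastforce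
qed simp

lemma F_prob: "F a = prob {\<omega> \<in> space M. W \<omega> \<le> a}"
proof -
  have "W -` {..a} \<inter> space M = {\<omega> \<in> space M. W \<omega> \<le> a}" by auto
  then show ?thesis by (simp add: F_def cdf_def measure_distr)
qed

lemma F_mono: "a \<le> b \<Longrightarrow> F a \<le> F b"
  unfolding F_prob by (rule finite_measure_mono) auto

lemma F_nonneg: "0 \<le> F a"
  by (simp add: F_prob)

text \<open>A distribution function is continuous exactly where the law has no atom, and a law with
  a Lebesgue density has none.\<close>

lemma F_isCont: "isCont F x"
proof -
  interpret D: prob_space "distr M borel W"
    by (rule prob_space_distr) simp
  interpret D': finite_borel_measure "distr M borel W"
    by unfold_locales simp_all
  have "distr M borel W = distr M lborel W"
    by (rule distr_cong) auto
  also have "\<dots> = density lborel f"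
    using density by (rule distributed_distr_eq_density)
  finally have eq: "distr M borel W = density lborel f" .
  have [measurable]: "f \<in> borel_measurable lborel"
    using density by (rule distributed_borel_measurable)
  have "emeasure (density lborel f) {x} = 0"
    by (subst emeasure_density) (auto intro!: nn_integral_null_set simp: null_sets_def)
  then show ?thesis
    unfolding F_def D'.isCont_cdf by (simp add: measure_def eq)
qed

lemma F_neg: "x < 0 \<Longrightarrow> F x = 0"
proof -
  assume "x < 0"
  then have "{\<omega> \<in> space M. W \<omega> \<le> x} = {}" using W_range by fastforce
  then show ?thesis by (simp only: F_prob measure_empty)
qed

lemma F_top: "cap_W S \<le> x \<Longrightarrow> F x = 1"
proof -
  assume "cap_W S \<le> x"
  then have "{\<omega> \<in> space M. W \<omega> \<le> x} = space M" using W_range by fastforce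
  then show ?thesis by (simp add: F_prob prob_space)
qed

section \<open>Convexity and derivative of the expected shortfall\<close>

text \<open>Pointwise, \<open>max 0 (s - W \<omega>)\<close> grows by \<open>b - a\<close> where
  \<open>W \<omega> \<le> a\<close>, by nothing where \<open>W \<omega> > b\<close>, and by
  something in between elsewhere. Integration gives these chord bounds, which carry the convexity
  arguments below.\<close>

lemma shortfall_increment:
  assumes "a \<le> b"
  shows "(b - a) * F a \<le> shortfall b - shortfall a"
    and "shortfall b - shortfall a \<le> (b - a) * F b"
proof -
  have diff: "shortfall b - shortfall a
      = expectation (\<lambda>\<omega>. max 0 (b - W \<omega>) - max 0 (a - W \<omega>))"
    unfolding shortfall_def by (simp add: integrable_shortfall)
  have int: "(b - a) * F c
      = expectation (\<lambda>\<omega>. (b - a) * indicator {\<omega> \<in> space M. W \<omega> \<le> c} \<omega>)" for c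
    by (simp add: F_prob)
  have integrable: "integrable M (\<lambda>\<omega>. (b - a) * indicator {\<omega> \<in> space M. W \<omega> \<le> c} \<omega>)"
    "integrable M (\<lambda>\<omega>. max 0 (b - W \<omega>) - max 0 (a - W \<omega>))" for c
    by (intro integrable_mult_right integrable_real_indicator; simp add: emeasure_eq_measure)
       (simp add: integrable_shortfall)
  show "(b - a) * F a \<le> shortfall b - shortfall a"
    unfolding diff int
    by (rule integral_mono; (rule integrable)?) (use assms in \<open>auto simp: indicator_def\<close>)
  show "shortfall b - shortfall a \<le> (b - a) * F b"
    unfolding diff int
    by (rule integral_mono; (rule integrable)?) (use assms in \<open>auto simp: indicator_def\<close>)
qed

text \<open>Convexity in another form: shifting an interval to the left does not enlarge the
  increment over it.\<close>

lemma shortfall_increment_mono: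
  assumes "a \<le> b" "0 \<le> c"
  shows "shortfall (b - c) - shortfall (a - c) \<le> shortfall b - shortfall a"
proof -
  have "expectation (\<lambda>\<omega>. max 0 (b - c - W \<omega>) - max 0 (a - c - W \<omega>))
      \<le> expectation (\<lambda>\<omega>. max 0 (b - W \<omega>) - max 0 (a - W \<omega>))"
    by (rule integral_mono; (intro Bochner_Integration.integrable_diff integrable_shortfall)?)
       (use assms in \<open>auto simp: max_def\<close>)
  then show ?thesis
    unfolding shortfall_def by (simp add: integrable_shortfall)
qed

text \<open>The chord bounds place the difference quotient between \<open>F x\<close> and
  \<open>F y\<close>, and \<open>F\<close> is continuous.\<close>

lemma DERIV_shortfall: "(shortfall has_real_derivative F x) (at x)"
proof -
  have "((\<lambda>y. (shortfall y - shortfall x) / (y - x)) \<longlongrightarrow> F x) (at x)"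
  proof (rule tendsto_sandwich)
    have lim: "(F \<longlongrightarrow> F x) (at x)" using F_isCont by (simp add: isCont_def)
    show "((\<lambda>y. min (F x) (F y)) \<longlongrightarrow> F x) (at x)"
      using tendsto_min[OF tendsto_const lim, of "F x"] by simp
    show "((\<lambda>y. max (F x) (F y)) \<longlongrightarrow> F x) (at x)"
      using tendsto_max[OF tendsto_const lim, of "F x"] by simp
    have "min (F x) (F y) \<le> (shortfall y - shortfall x) / (y - x) \<and>
      (shortfall y - shortfall x) / (y - x) \<le> max (F x) (F y)" if "y \<noteq> x" for y
    proof (cases "x < y")
      case True
      then show ?thesis
        using shortfall_increment[of x y] F_mono[of x y]
        by (simp add: pos_le_divide_eq pos_divide_le_eq mult.commute)
    next
      case False
      with that have "y < x" by simp
      then show ?thesis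
        using shortfall_increment[of y x] F_mono[of y x]
        by (simp add: neg_le_divide_eq neg_divide_le_eq algebra_simps)
    qed
    then show "\<forall>\<^sub>F y in at x. min (F x) (F y) \<le> (shortfall y - shortfall x) / (y - x)"
      and "\<forall>\<^sub>F y in at x. (shortfall y - shortfall x) / (y - x) \<le> max (F x) (F y)"
      by (auto simp: eventually_at_filter)
  qed
  then show ?thesis by (simp add: has_field_derivative_iff)
qed

lemma shortfall_isCont: "isCont shortfall x"
  using DERIV_shortfall DERIV_isCont by blast

section \<open>Marginal costs and the thresholds \<open>l1\<close> and \<open>l2\<close>\<close>

text \<open>An antiderivative of \<open>A_fun S F\<close>; it is also the expected optimal real-time
  cost of the schedule \<open>s\<close> when no flexible unit is committed.\<close>

definition cum_A :: "real \<Rightarrow> real" where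
  "cum_A s = c_F_up S * shortfall s + (voll S - c_F_up S) * shortfall (s - cap_F S)"

definition marginal_F :: "real \<Rightarrow> real" where
  "marginal_F p = (c_F_up S - c_F_dn S) * F p - (c_F S - c_F_dn S)"

lemma c_F_up_pos: "0 < c_F_up S"
  using costs c_F_pos by linarith

lemma A_fun_mono: "a \<le> b \<Longrightarrow> A_fun S F a \<le> A_fun S F b"
  unfolding A_fun_def using costs c_F_up_pos
  by (intro add_mono mult_left_mono F_mono) auto

lemma A_fun_isCont: "isCont (A_fun S F) x"
proof -
  have "isCont (\<lambda>s. F (s - cap_F S)) x"
    by (rule isCont_o2[where g = F]) (auto intro: F_isCont continuous_intros)
  then show ?thesis unfolding A_fun_def[abs_def] by (intro continuous_intros F_isCont)
qed

lemma cum_A_increment: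
  assumes "a \<le> b"
  shows "(b - a) * A_fun S F a \<le> cum_A b - cum_A a"
    and "cum_A b - cum_A a \<le> (b - a) * A_fun S F b"
proof -
  note i = shortfall_increment[OF assms] shortfall_increment[of "a - cap_F S" "b - cap_F S"]
  have c: "0 \<le> c_F_up S" "0 \<le> voll S - c_F_up S" using costs c_F_up_pos by auto
  show "(b - a) * A_fun S F a \<le> cum_A b - cum_A a"
    using mult_left_mono[OF i(1) c(1)] mult_left_mono[OF i(3) c(2)] assms
    by (simp add: A_fun_def cum_A_def algebra_simps)
  show "cum_A b - cum_A a \<le> (b - a) * A_fun S F b"
    using mult_left_mono[OF i(2) c(1)] mult_left_mono[OF i(4) c(2)] assms
    by (simp add: A_fun_def cum_A_def algebra_simps)
qed

lemma cum_A_increment_mono: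
  assumes "a \<le> b" "0 \<le> c"
  shows "cum_A (b - c) - cum_A (a - c) \<le> cum_A b - cum_A a"
proof -
  have c: "0 \<le> c_F_up S" "0 \<le> voll S - c_F_up S" using costs c_F_up_pos by auto
  show ?thesis
    using mult_left_mono[OF shortfall_increment_mono[OF assms] c(1)]
      mult_left_mono[OF shortfall_increment_mono[of "a - cap_F S" "b - cap_F S" c] c(2)] assms
    by (simp add: cum_A_def algebra_simps)
qed

text \<open>Under either reading of the generalized inverse, \<open>F \<le> \<alpha>\<close> to the
  left of \<open>l1\<close> and \<open>F \<ge> \<alpha>\<close> to the right. Continuity gives
  \<open>F l1 = \<alpha>\<close>, and \<open>marginal_F\<close> is a positive multiple of
  \<open>F - \<alpha>\<close>.\<close>

lemma load_1_facts:
  shows l1_nonneg: "0 \<le> l1" and l1_le_cap_W: "l1 \<le> cap_W S"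
    and marginal_F_nonpos: "\<And>s. s \<le> l1 \<Longrightarrow> marginal_F s \<le> 0"
    and marginal_F_nonneg: "\<And>s. l1 \<le> s \<Longrightarrow> 0 \<le> marginal_F s"
proof -
  define \<alpha> where "\<alpha> = (c_F S - c_F_dn S) / (c_F_up S - c_F_dn S)"
  \<comment> \<open>The case \<open>\<alpha> = 0\<close> occurs when
    \<open>c_F S = c_F_dn S\<close>; the strict inequality then keeps the set bounded below.\<close>
  define X where "X = (if \<alpha> = 0 then {x. F x > 0} else {x. F x \<ge> \<alpha>})"
  have \<alpha>: "0 \<le> \<alpha>" "\<alpha> \<le> 1" using costs by (auto simp: \<alpha>_def)
  have l1: "l1 = Inf X"
    by (simp add: l1_def load_1_def gen_inverse_def X_def \<alpha>_def)
  have lower: "0 \<le> x" if "x \<in> X" for x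
    using that \<alpha> F_neg[of x] by (cases "x < 0") (auto simp: X_def split: if_splits)
  have bdd: "bdd_below X" using lower by (auto simp: bdd_below_def)
  have cW: "cap_W S \<in> X" using \<alpha> F_top[of "cap_W S"] by (auto simp: X_def)
  show "0 \<le> l1" unfolding l1 using cW lower by (intro cInf_greatest) auto
  show "l1 \<le> cap_W S" unfolding l1 using cW bdd by (rule cInf_lower)
  have left: "F s \<le> \<alpha>" if "s < l1" for s
  proof -
    have "s \<notin> X" using that cInf_lower[OF _ bdd, of s] by (auto simp: l1)
    then show ?thesis by (auto simp: X_def split: if_splits)
  qed
  have right: "\<alpha> \<le> F s" if "l1 < s" for s
  proof -
    have "\<exists>x\<in>X. x < s" using that cW unfolding l1 by (intro cInf_lessD) auto
    then obtain x where "x \<in> X" "x < s" by blast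
    then show ?thesis using F_mono[of x s] by (auto simp: X_def split: if_splits)
  qed
  have *: "F l1 \<le> \<alpha>" "\<alpha> \<le> F l1"
    using isCont_le_from_left[OF F_isCont left] isCont_ge_from_right[OF F_isCont right] by auto
  have m: "marginal_F s = (c_F_up S - c_F_dn S) * (F s - \<alpha>)" for s
    using costs by (simp add: marginal_F_def \<alpha>_def field_simps)
  show "marginal_F s \<le> 0" if "s \<le> l1" for s
    unfolding m using costs F_mono[OF that] * by (intro mult_nonneg_nonpos) auto
  show "0 \<le> marginal_F s" if "l1 \<le> s" for s
    unfolding m using costs F_mono[OF that] * by (intro mult_nonneg_nonneg) auto
qed

text \<open>Continuity of \<open>A_fun S F\<close> makes the admissible set closed, so its infimum
  is attained and is the \<open>LEAST\<close> element. The set contains \<open>cap_W S\<close>,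
  where \<open>A_fun\<close> is at least \<open>c_F_up S\<close>, which exceeds
  \<open>c_I S\<close>.\<close>

lemma load_2_facts:
  shows l2_nonneg: "0 \<le> l2" and l2_le_cap_W: "l2 \<le> cap_W S"
    and A_fun_le_c_I: "\<And>s. s \<le> l2 \<Longrightarrow> A_fun S F s \<le> c_I S"
    and A_fun_ge_c_I: "\<And>s. l2 \<le> s \<Longrightarrow> c_I S \<le> A_fun S F s"
proof -
  define X where "X = {x. 0 \<le> x \<and> c_I S \<le> A_fun S F x}"
  have bdd: "bdd_below X" by (auto simp: bdd_below_def X_def)
  have "c_I S \<le> A_fun S F (cap_W S)"
  proof -
    have "0 \<le> (voll S - c_F_up S) * F (cap_W S - cap_F S)"
      using costs F_nonneg by (intro mult_nonneg_nonneg) auto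
    then show ?thesis
      using costs c_I_less by (simp add: A_fun_def F_top)
  qed
  then have cW: "cap_W S \<in> X" using cap_W_pos by (simp add: X_def)
  have "continuous_on UNIV (A_fun S F)"
    using A_fun_isCont by (simp add: continuous_on_eq_continuous_at)
  then have "closed X"
    unfolding X_def by (intro closed_Collect_conj closed_Collect_le continuous_intros) auto
  then have Inf: "Inf X \<in> X" using cW bdd by (intro closed_contains_Inf) auto
  have l2: "l2 = Inf X"
    unfolding l2_def load_2_def using Inf cInf_lower[OF _ bdd]
    by (intro Least_equality) (auto simp: X_def)
  show l2_0: "0 \<le> l2" using Inf by (auto simp: l2 X_def)
  show "l2 \<le> cap_W S" unfolding l2 using cW bdd by (rule cInf_lower)
  have "A_fun S F s \<le> c_I S" if "s < l2" for s
  \<comment> \<open>Negative arguments are excluded from \<open>X\<close> by definition, so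
    minimality says nothing about them; there \<open>A_fun\<close> is zero.\<close>
  proof (cases "s < 0")
    case True
    then show ?thesis using c_I_pos F_neg cap_F_pos by (simp add: A_fun_def)
  next
    case False
    then show ?thesis using that cInf_lower[OF _ bdd, of s] by (force simp: l2 X_def)
  qed
  then have "A_fun S F l2 \<le> c_I S" by (rule isCont_le_from_left[OF A_fun_isCont])
  then show "A_fun S F s \<le> c_I S" if "s \<le> l2" for s
    using A_fun_mono[OF that] by simp
  show "c_I S \<le> A_fun S F s" if "l2 \<le> s" for s
    using A_fun_mono[OF that] Inf by (simp add: l2 X_def)
qed

section \<open>The two branches of the cost and their minimizers\<close>

text \<open>\<open>value_a l p\<close> is the expected cost at load \<open>l\<close> when \<open>p\<^sub>W = p\<close> and \<open>p\<^sub>F = 0\<close>; \<open>value_b k p\<close> is the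
  one at load \<open>k + cap_I\<close> when \<open>p\<^sub>W = p\<close> and \<open>p\<^sub>I = cap_I\<close>. The latter is written so that the part
  depending on \<open>p\<close> vanishes at the kink \<open>p = k\<close>.\<close>

definition value_a :: "real \<Rightarrow> real \<Rightarrow> real" where
  "value_a l p = c_I S * (l - p) + cum_A p"

definition value_b :: "real \<Rightarrow> real \<Rightarrow> real" where
  "value_b k p = c_I S * cap_I S + (c_F S - c_F_dn S) * (k - p)
     - (c_F_up S - c_F_dn S) * (shortfall k - shortfall p) + cum_A k"

lemma value_a_antimono:
  assumes "p \<le> q" "q \<le> l2"
  shows "value_a l q \<le> value_a l p"
proof -
  have "cum_A q - cum_A p \<le> (q - p) * A_fun S F q" by (rule cum_A_increment) fact
  also have "\<dots> \<le> (q - p) * c_I S" using assms A_fun_le_c_I by (intro mult_left_mono) auto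
  finally show ?thesis by (simp add: value_a_def algebra_simps)
qed

lemma value_a_mono:
  assumes "l2 \<le> p" "p \<le> q"
  shows "value_a l p \<le> value_a l q"
proof -
  have "(q - p) * c_I S \<le> (q - p) * A_fun S F p"
    using assms A_fun_ge_c_I by (intro mult_left_mono) auto
  also have "\<dots> \<le> cum_A q - cum_A p" by (rule cum_A_increment) fact
  finally show ?thesis by (simp add: value_a_def algebra_simps)
qed

text \<open>The middle term is \<open>value_b k q - value_b k p\<close> for every \<open>k\<close>,
  so \<open>marginal_F\<close> is the slope of that branch.\<close>

lemma marginal_F_increment:
  assumes "p \<le> q"
  shows "(q - p) * marginal_F p
      \<le> (c_F_up S - c_F_dn S) * (shortfall q - shortfall p) - (c_F S - c_F_dn S) * (q - p)"
    and "(c_F_up S - c_F_dn S) * (shortfall q - shortfall p) - (c_F S - c_F_dn S) * (q - p)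
      \<le> (q - p) * marginal_F q"
  using mult_left_mono[OF shortfall_increment(1)[OF assms], of "c_F_up S - c_F_dn S"]
    mult_left_mono[OF shortfall_increment(2)[OF assms], of "c_F_up S - c_F_dn S"] costs
  by (simp_all add: marginal_F_def algebra_simps)

lemma value_b_antimono:
  assumes "p \<le> q" "q \<le> l1"
  shows "value_b k q \<le> value_b k p"
  using marginal_F_increment(2)[OF assms(1)]
    mult_nonneg_nonpos[of "q - p" "marginal_F q"] marginal_F_nonpos[OF assms(2)] assms(1)
  by (simp add: value_b_def algebra_simps)

lemma value_b_mono:
  assumes "l1 \<le> p" "p \<le> q"
  shows "value_b k p \<le> value_b k q"
  using marginal_F_increment(1)[OF assms(2)]
    mult_nonneg_nonneg[of "q - p" "marginal_F p"] marginal_F_nonneg[OF assms(1)] assms(2)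
  by (simp add: value_b_def algebra_simps)

lemma value_a_eq_value_b: "value_a (k + cap_I S) k = value_b k k"
  by (simp add: value_a_def value_b_def)

text \<open>The branch falls up to \<open>l2\<close> and rises afterwards, so the best schedule is
  \<open>l2\<close> clipped at the load.\<close>

lemma value_a_min:
  assumes "p \<le> l"
  shows "value_a l (min l l2) \<le> value_a l p"
  using value_a_antimono[of p "min l l2" l] value_a_mono[of l2 p l] assms
  by (cases "p \<le> l2") (auto simp: min_def)

text \<open>The turning point is \<open>l1\<close>, clipped from below because the flexible output
  \<open>k - p\<close> is at most \<open>cap_F S\<close>.\<close>

lemma value_b_min:
  assumes "k - cap_F S \<le> p"
  shows "value_b k (max l1 (k - cap_F S)) \<le> value_b k p"
  using value_b_antimono[of p "max l1 (k - cap_F S)" k]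
    value_b_mono[of "max l1 (k - cap_F S)" p k] assms value_b_mono[of l1 "k - cap_F S" k]
  by (cases "p \<le> l1") (auto simp: max_def split: if_splits)

section \<open>Comparing the two local minima\<close>

text \<open>Neither schedule is clipped at the kink \<open>l - cap_I S\<close>. For
  \<open>l1 + cap_I S \<le> l \<le> l2 + cap_I S\<close> each of them lies on its own side
  anyway.\<close>

definition gap :: "real \<Rightarrow> real" where
  "gap l = value_b (l - cap_I S) (max l1 (l - cap_I S - cap_F S)) - value_a l (min l l2)"

text \<open>After subtraction of \<open>cum_A k\<close> the slope is \<open>- marginal_F k\<close>
  while \<open>l1\<close> is scheduled, and a negative multiple of
  \<open>F k - F (k - cap_F S)\<close> once the flexible unit is full. Both are nonpositive.\<close>

lemma value_b_best_increment:
  assumes "l1 \<le> k" "k \<le> k'"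
  shows "value_b k' (max l1 (k' - cap_F S)) - value_b k (max l1 (k - cap_F S))
      \<le> cum_A k' - cum_A k"
proof -
  define \<psi> where "\<psi> = (\<lambda>k. value_b k (max l1 (k - cap_F S)) - cum_A k)"
  let ?m = "l1 + cap_F S"
  have low: "\<psi> b \<le> \<psi> a" if "l1 \<le> a" "a \<le> b" "b \<le> ?m" for a b
  proof -
    have "max l1 (a - cap_F S) = l1" "max l1 (b - cap_F S) = l1" using that by auto
    then show ?thesis
      using marginal_F_increment(1)[OF that(2)]
        mult_nonneg_nonneg[of "b - a" "marginal_F a"] marginal_F_nonneg[OF that(1)] that
      by (simp add: \<psi>_def value_b_def algebra_simps)
  qed
  have high: "\<psi> b \<le> \<psi> a" if "?m \<le> a" "a \<le> b" for a b
    using mult_left_mono[OF shortfall_increment_mono[OF that(2), of "cap_F S"],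
        of "c_F_up S - c_F_dn S"] that costs cap_F_pos
    by (simp add: \<psi>_def value_b_def max_def algebra_simps)
  have "\<psi> k' \<le> \<psi> k"
    using low[of k k'] high[of k k'] low[of k ?m] high[of ?m k'] assms
    by (cases "k' \<le> ?m"; cases "?m \<le> k") auto
  then show ?thesis by (simp add: \<psi>_def)
qed

text \<open>While the whole load is scheduled, convexity of \<open>cum_A\<close> suffices. Beyond
  \<open>l2\<close> the cost grows at rate \<open>c_I S\<close>, which bounds \<open>A_fun\<close>
  at \<open>l - cap_I S \<le> l2\<close>.\<close>

lemma value_a_best_increment:
  assumes "l \<le> l'" "l' \<le> l2 + cap_I S"
  shows "cum_A (l' - cap_I S) - cum_A (l - cap_I S)
      \<le> value_a l' (min l' l2) - value_a l (min l l2)"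
proof -
  define \<phi> where "\<phi> = (\<lambda>l. value_a l (min l l2) - cum_A (l - cap_I S))"
  have low: "\<phi> a \<le> \<phi> b" if "a \<le> b" "b \<le> l2" for a b
    using cum_A_increment_mono[OF that(1), of "cap_I S"] that cap_I_pos
    by (simp add: \<phi>_def value_a_def min_def)
  have high: "\<phi> a \<le> \<phi> b" if "l2 \<le> a" "a \<le> b" "b \<le> l2 + cap_I S" for a b
  proof -
    have "cum_A (b - cap_I S) - cum_A (a - cap_I S) \<le> (b - a) * A_fun S F (b - cap_I S)"
      using cum_A_increment(2)[of "a - cap_I S" "b - cap_I S"] that by simp
    also have "\<dots> \<le> (b - a) * c_I S"
      using that A_fun_le_c_I by (intro mult_left_mono) auto
    finally show ?thesis
      using that by (simp add: \<phi>_def value_a_def min_absorb2 algebra_simps)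
  qed
  have "\<phi> l \<le> \<phi> l'"
    using low[of l l'] high[of l l'] low[of l l2] high[of l2 l'] assms
    by (cases "l' \<le> l2"; cases "l2 \<le> l") auto
  then show ?thesis by (simp add: \<phi>_def)
qed

lemma gap_antimono:
  assumes "l1 + cap_I S \<le> l" "l \<le> l'" "l' \<le> l2 + cap_I S"
  shows "gap l' \<le> gap l"
  using value_b_best_increment[of "l - cap_I S" "l' - cap_I S"]
    value_a_best_increment[of l l'] assms
  by (simp add: gap_def)

lemma gap_isCont: "isCont gap x"
proof -
  have s: "isCont (\<lambda>x. shortfall (g x)) x" if "isCont g x" for g :: "real \<Rightarrow> real"
    using that shortfall_isCont by (rule isCont_o2)
  show ?thesis
    unfolding gap_def[abs_def] value_a_def value_b_def cum_A_def
    by (intro continuous_intros s)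
qed

text \<open>At either end of the range the kink coincides with the optimum of one branch. It is also
  available to the other branch, which can only do better, so \<open>gap\<close> changes
  sign.\<close>

lemma ex_gap_zero:
  assumes "l1 < l2"
  shows "\<exists>x. l1 + cap_I S \<le> x \<and> x \<le> l2 + cap_I S \<and> gap x = 0"
proof (rule IVT2)
  show "gap (l2 + cap_I S) \<le> 0"
    using value_a_eq_value_b[of l2] value_b_min[of l2 l2] cap_F_pos cap_I_pos
    by (simp add: gap_def)
  show "0 \<le> gap (l1 + cap_I S)"
    using value_a_eq_value_b[of l1] value_a_min[of l1 "l1 + cap_I S"] cap_F_pos cap_I_pos
    by (simp add: gap_def max_def)
qed (use assms gap_isCont in auto)

section \<open>The equation for \<open>l8\<close> in closed form\<close>

lemma LBINT_F:
  fixes c d e r t :: real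
  assumes "a \<le> b"
  shows "(LBINT s = ereal a..ereal b. c * F s + d * F (s - r) + e) =
    c * (shortfall b - shortfall a) + d * (shortfall (b - r) - shortfall (a - r)) + e * (b - a)"
proof -
  define P where "P = (\<lambda>s. c * shortfall s + d * shortfall (s - r) + e * s)"
  have shift: "isCont (\<lambda>s. F (s - r)) x" for x
    by (rule isCont_o2[where g = F]) (auto intro: F_isCont continuous_intros)
  have dshift: "((\<lambda>s. shortfall (s - r)) has_real_derivative F (x - r)) (at x)" for x
    using DERIV_shortfall[of "x - r"] DERIV_shift[of shortfall "F (x - r)" x "- r"] by simp
  have "(LBINT s = ereal a..ereal b. c * F s + d * F (s - r) + e) = P b - P a"
  proof (rule interval_integral_FTC_finite)
    show "continuous_on {min a b..max a b} (\<lambda>s. c * F s + d * F (s - r) + e)"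
      by (intro continuous_at_imp_continuous_on ballI continuous_intros F_isCont shift)
    show "(P has_vector_derivative c * F x + d * F (x - r) + e) (at x within {min a b..max a b})"
      for x
      unfolding has_real_derivative_iff_has_vector_derivative[symmetric] P_def
      by (rule DERIV_subset[of _ _ _ UNIV])
         (auto intro!: derivative_eq_intros DERIV_shortfall dshift)
  qed
  then show ?thesis by (simp add: P_def algebra_simps)
qed

lemma is_load_8_iff:
  "is_load_8 S F x \<longleftrightarrow> l1 + cap_I S \<le> x \<and> x \<le> l2 + cap_I S \<and> gap x = 0"
proof (cases "l1 + cap_I S \<le> x \<and> x \<le> l2 + cap_I S")
  case True
  define k where "k = x - cap_I S"
  have k: "l1 \<le> k" "k \<le> l2" "k \<le> min x l2" using True cap_I_pos by (auto simp: k_def)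
  \<comment> \<open>The curtailment terms cancel in this difference; the zero coefficient and zero
    shift only match the shape of \<open>LBINT_F\<close>.\<close>
  have AB: "A_fun S F s - B_fun S F s
      = (c_F_up S - c_F_dn S) * F s + 0 * F (s - 0) + (c_F_dn S - c_F S)" for s
    by (simp add: A_fun_def B_fun_def algebra_simps)
  have AC: "A_fun S F s - C_fun S F s
      = (c_F_up S - c_F_dn S) * F s + (c_F_dn S - c_F_up S) * F (s - cap_F S) + 0" for s
    by (simp add: A_fun_def C_fun_def algebra_simps)
  have A: "A_fun S F s = c_F_up S * F s + (voll S - c_F_up S) * F (s - cap_F S) + 0" for s
    by (simp add: A_fun_def)
  have iA: "(LBINT s = ereal k..ereal (min x l2). A_fun S F s) = cum_A (min x l2) - cum_A k"
    unfolding A by (subst LBINT_F) (use k in \<open>auto simp: cum_A_def algebra_simps\<close>)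
  have iAB: "(LBINT s = ereal (min k l1)..ereal (min k (l1 + cap_F S)). A_fun S F s - B_fun S F s)
    = (c_F_up S - c_F_dn S) * (shortfall (min k (l1 + cap_F S)) - shortfall l1)
      + (c_F_dn S - c_F S) * (min k (l1 + cap_F S) - l1)"
    unfolding AB by (subst LBINT_F) (use k cap_F_pos in \<open>auto simp: min_absorb2\<close>)
  have iAC: "(LBINT s = ereal (min k (l1 + cap_F S))..ereal k. A_fun S F s - C_fun S F s)
    = (c_F_up S - c_F_dn S) * (shortfall k - shortfall (min k (l1 + cap_F S)))
      - (c_F_up S - c_F_dn S)
        * (shortfall (k - cap_F S) - shortfall (min k (l1 + cap_F S) - cap_F S))"
    unfolding AC by (subst LBINT_F) (auto simp: algebra_simps)
  have "c_I S * (cap_I S - max (x - l2) 0)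
        - (LBINT s = ereal (min k l1)..ereal (min k (l1 + cap_F S)). A_fun S F s - B_fun S F s)
        - (LBINT s = ereal (min k (l1 + cap_F S))..ereal k. A_fun S F s - C_fun S F s)
        - (LBINT s = ereal k..ereal (min x l2). A_fun S F s) = gap x"
    unfolding iA iAB iAC gap_def value_a_def value_b_def k_def[symmetric]
    by (cases "k \<le> l1 + cap_F S"; cases "x \<le> l2")
       (auto simp: min_def max_def algebra_simps)
  then show ?thesis
    using True unfolding is_load_8_def Let_def l1_def[symmetric] l2_def[symmetric] k_def by simp
next
  case False
  then show ?thesis
    by (auto simp: is_load_8_def Let_def l1_def[symmetric] l2_def[symmetric])
qed

section \<open>Optimal recourse and reduction to the forward dispatch\<close>

text \<open>The optimal real-time cost is piecewise linear in \<open>w\<close>, with slopes \<open>0\<close>, \<open>c_F_dn\<close>, \<open>c_F_up\<close>, \<open>voll\<close>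
  in the shortage \<open>pW - w\<close>; it is written here as a combination of shortfalls.\<close>

definition recourse :: "real \<Rightarrow> real \<Rightarrow> real \<Rightarrow> real" where
  "recourse pW pF w = c_F_dn S * (max 0 (pW + pF - w) - pF)
     + (c_F_up S - c_F_dn S) * max 0 (pW - w)
     + (voll S - c_F_up S) * max 0 (pW + pF - cap_F S - w)"

definition forward_cost :: "real \<Rightarrow> real \<Rightarrow> real \<Rightarrow> real" where
  "forward_cost pW pI pF = c_I S * pI + c_F S * pF + c_F_dn S * (shortfall (pW + pF) - pF)
     + (c_F_up S - c_F_dn S) * shortfall pW
     + (voll S - c_F_up S) * shortfall (pW + pF - cap_F S)"

lemma expectation_recourse:
  "c_I S * pI + c_F S * pF + expectation (\<lambda>\<omega>. recourse pW pF (W \<omega>)) = forward_cost pW pI pF"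
  unfolding recourse_def forward_cost_def shortfall_def
  by (simp add: integrable_shortfall prob_space)

lemma integrable_recourse: "integrable M (\<lambda>\<omega>. recourse pW pF (W \<omega>))"
  unfolding recourse_def by (simp add: integrable_shortfall)

text \<open>Abel summation over the prices \<open>c_F_dn\<close>, \<open>c_F_up\<close>,
  \<open>voll\<close>: each price step is nonnegative and multiplies a shortage that the constraints
  bound by \<open>u - d + sh\<close>, \<open>u + sh\<close> and \<open>sh\<close>
  respectively.\<close>

lemma recourse_le:
  assumes "u - d + dw + sh = 0" "0 \<le> u" "u \<le> cap_F S - pF" "0 \<le> d" "d \<le> pF"
    "pW + dw \<le> w" "0 \<le> sh"
  shows "recourse pW pF w \<le> c_F_up S * u - c_F_dn S * d + voll S * sh"
proof -
  have "max 0 (pW + pF - w) - pF \<le> u - d + sh" using assms by auto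
  then have "c_F_dn S * (max 0 (pW + pF - w) - pF) \<le> c_F_dn S * (u - d + sh)"
    using costs by (intro mult_left_mono) auto
  moreover have "(c_F_up S - c_F_dn S) * max 0 (pW - w) \<le> (c_F_up S - c_F_dn S) * (u + sh)"
    using assms costs by (intro mult_left_mono) auto
  moreover have "(voll S - c_F_up S) * max 0 (pW + pF - cap_F S - w) \<le> (voll S - c_F_up S) * sh"
    using assms costs by (intro mult_left_mono) auto
  ultimately show ?thesis by (simp add: recourse_def algebra_simps)
qed

definition forward_feasible :: "real \<Rightarrow> real \<Rightarrow> real \<Rightarrow> real \<Rightarrow> bool" where
  "forward_feasible l pW pI pF \<longleftrightarrow> 0 \<le> pW \<and> pW \<le> cap_W S \<and>
    pF + pI + pW = l \<and> 0 \<le> pF \<and> pF \<le> cap_F S \<and> 0 \<le> pI \<and> pI \<le> cap_I S \<and>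
    (pF = 0 \<or> pI = cap_I S)"

lemma BL_feasible_forward:
  assumes "BL_feasible S M W l x"
  shows "forward_feasible l (p_W x) (p_I x) (p_F x)"
  using assms lower_level_optimal_iff[OF c_I_less cap_I_pos cap_F_pos]
  by (auto simp: BL_feasible_def forward_feasible_def)

lemma BL_cost_ge:
  assumes "BL_feasible S M W l x"
  shows "forward_cost (p_W x) (p_I x) (p_F x) \<le> BL_cost S M x"
proof -
  have [measurable]: "up x \<in> borel_measurable M" "dn x \<in> borel_measurable M"
      "shed x \<in> borel_measurable M"
    and bnd: "\<And>\<omega>. \<omega> \<in> space M \<Longrightarrow> up x \<omega> - dn x \<omega> + dW x \<omega> + shed x \<omega> = 0 \<and>
        0 \<le> up x \<omega> \<and> up x \<omega> \<le> cap_F S - p_F x \<and> 0 \<le> dn x \<omega> \<and> dn x \<omega> \<le> p_F x \<and>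
        0 \<le> p_W x + dW x \<omega> \<and> p_W x + dW x \<omega> \<le> W \<omega> \<and> 0 \<le> shed x \<omega> \<and> shed x \<omega> \<le> l"
    using assms by (auto simp: BL_feasible_def)
  \<comment> \<open>The capacity and load bounds make the measurable decisions bounded.\<close>
  have "integrable M (up x)" "integrable M (dn x)" "integrable M (shed x)"
    by (rule integrable_const_bound[where B = "cap_F S - p_F x"]
          integrable_const_bound[where B = "p_F x"] integrable_const_bound[where B = l];
        use bnd in \<open>fastforce intro!: AE_I2\<close>)+
  then have "expectation (\<lambda>\<omega>. recourse (p_W x) (p_F x) (W \<omega>))
    \<le> expectation (\<lambda>\<omega>. c_F_up S * up x \<omega> - c_F_dn S * dn x \<omega> + voll S * shed x \<omega>)"
    by (intro integral_mono integrable_recourse)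
       (use bnd in \<open>auto intro!: recourse_le[where dw = "dW x _"]\<close>)
  then show ?thesis
    unfolding BL_cost_def expectation_recourse[symmetric] by simp
qed

text \<open>The lower bound \<open>forward_cost\<close> is attained by greedy recourse: a shortage
  is met by upward regulation up to the headroom and then by curtailment, a surplus by downward
  regulation.\<close>

lemma ex_BL_decision:
  assumes "forward_feasible l pW pI pF"
  shows "\<exists>x. BL_feasible S M W l x \<and> BL_cost S M x = forward_cost pW pI pF \<and>
    (p_W x, p_I x, p_F x) = (pW, pI, pF)"
proof -
  note ff = assms[unfolded forward_feasible_def]
  define u where "u = (\<lambda>\<omega>. min (max 0 (pW - W \<omega>)) (cap_F S - pF))"
  define d where "d = (\<lambda>\<omega>. min pF (max 0 (W \<omega> - pW)))"
  define h where "h = (\<lambda>\<omega>. max 0 (pW + pF - cap_F S - W \<omega>))"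
  define x where "x = \<lparr>p_W = pW, p_I = pI, p_F = pF, up = u, dn = d,
    dW = (\<lambda>\<omega>. d \<omega> - u \<omega> - h \<omega>), shed = h\<rparr>"
  have feas: "BL_feasible S M W l x"
    unfolding BL_feasible_def lower_level_optimal_iff[OF c_I_less cap_I_pos cap_F_pos]
  proof (intro conjI ballI)
    fix \<omega> assume "\<omega> \<in> space M"
    note w = W_range[OF this]
    show "0 \<le> p_W x + dW x \<omega>" "p_W x + dW x \<omega> \<le> W \<omega>" "shed x \<omega> \<le> l"
      using w ff by (auto simp: x_def u_def d_def h_def min_def max_def)
  qed (use ff in \<open>auto simp: x_def u_def d_def h_def\<close>)
  have "c_F_up S * u \<omega> - c_F_dn S * d \<omega> + voll S * h \<omega> = recourse pW pF (W \<omega>)" for \<omega>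
  proof -
    \<comment> \<open>For the greedy decisions the three shortage bounds behind
      \<open>recourse_le\<close> hold with equality.\<close>
    have *: "max 0 (pW + pF - W \<omega>) - pF = u \<omega> + h \<omega> - d \<omega>" "max 0 (pW - W \<omega>) = u \<omega> + h \<omega>"
      "max 0 (pW + pF - cap_F S - W \<omega>) = h \<omega>"
      using ff by (auto simp: u_def d_def h_def min_def max_def)
    show ?thesis
      unfolding recourse_def * by (simp add: algebra_simps)
  qed
  then have "BL_cost S M x = forward_cost pW pI pF"
    by (simp add: BL_cost_def x_def expectation_recourse[symmetric])
  with feas show ?thesis by (intro exI[of _ x]) (simp add: x_def)
qed

lemma forward_cost_value_a: "forward_cost pW pI 0 = value_a (pW + pI) pW"
  by (simp add: forward_cost_def value_a_def cum_A_def algebra_simps)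

lemma forward_cost_value_b: "forward_cost pW (cap_I S) pF = value_b (pW + pF) pW"
  by (simp add: forward_cost_def value_b_def cum_A_def algebra_simps)

section \<open>Optimality criteria for the candidate dispatches\<close>

text \<open>The merit order leaves only dispatches with \<open>pF = 0\<close> or
  \<open>pI = cap_I S\<close>, so every competitor lies on one of two one-dimensional
  branches.\<close>

lemma BL_solution_forwardI:
  assumes "forward_feasible l pW pI pF"
    and a: "\<And>p. l - cap_I S \<le> p \<Longrightarrow> p \<le> l \<Longrightarrow> forward_cost pW pI pF \<le> value_a l p"
    and b: "\<And>p. l - cap_I S - cap_F S \<le> p \<Longrightarrow> p \<le> l - cap_I S \<Longrightarrow>
      forward_cost pW pI pF \<le> value_b (l - cap_I S) p"
  shows "BL_solution_forward S M W l (pW, pI, pF)"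
proof -
  obtain x where x: "BL_feasible S M W l x" "BL_cost S M x = forward_cost pW pI pF"
    "(p_W x, p_I x, p_F x) = (pW, pI, pF)"
    using ex_BL_decision[OF assms(1)] by blast
  have "BL_cost S M x \<le> BL_cost S M y" if y: "BL_feasible S M W l y" for y
  proof -
    note ff = BL_feasible_forward[OF y, unfolded forward_feasible_def]
    have "forward_cost pW pI pF \<le> forward_cost (p_W y) (p_I y) (p_F y)"
    proof (cases "p_F y = 0")
      case True
      then have "p_W y + p_I y = l" using ff by auto
      then have "forward_cost (p_W y) (p_I y) (p_F y) = value_a l (p_W y)"
        using True forward_cost_value_a[of "p_W y" "p_I y"] by simp
      then show ?thesis using a[of "p_W y"] True ff by auto
    next
      case False
      then have "p_I y = cap_I S" "p_W y + p_F y = l - cap_I S" using ff by auto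
      then have "forward_cost (p_W y) (p_I y) (p_F y) = value_b (l - cap_I S) (p_W y)"
        using forward_cost_value_b[of "p_W y" "p_F y"] by simp
      then show ?thesis using b[of "p_W y"] \<open>p_W y + p_F y = l - cap_I S\<close> ff by auto
    qed
    then show ?thesis using BL_cost_ge[OF y] x(2) by linarith
  qed
  then show ?thesis
    unfolding BL_solution_forward_def is_arg_min_def using x by (fastforce simp: not_less)
qed

text \<open>If the kink is at most \<open>l1\<close>, the other branch falls all the way to the
  kink, a point shared with this branch, so no comparison of minima is needed.
  \<open>optimal_b\<close> is the mirror image.\<close>

lemma optimal_a:
  assumes "forward_feasible l pW pI 0" "pW = min l l2"
    and "value_a l (min l l2) \<le> value_b (l - cap_I S) (max l1 (l - cap_I S - cap_F S)) \<or>
      l - cap_I S \<le> l1"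
  shows "BL_solution_forward S M W l (pW, pI, 0)"
proof (rule BL_solution_forwardI[OF assms(1)])
  have cost: "forward_cost pW pI 0 = value_a l (min l l2)"
    using assms by (simp add: forward_cost_value_a forward_feasible_def add.commute)
  show "forward_cost pW pI 0 \<le> value_a l p" if "p \<le> l" for p
    using value_a_min[OF that] cost by simp
  show "forward_cost pW pI 0 \<le> value_b (l - cap_I S) p"
    if p: "l - cap_I S - cap_F S \<le> p" "p \<le> l - cap_I S" for p
    using assms(3)
  proof
    assume "l - cap_I S \<le> l1"
    then show ?thesis
      using value_b_antimono[OF p(2), of "l - cap_I S"] value_a_eq_value_b[of "l - cap_I S"]
        value_a_min[of "l - cap_I S" l] cap_I_pos cost by simp
  next
    assume "value_a l (min l l2) \<le> value_b (l - cap_I S) (max l1 (l - cap_I S - cap_F S))"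
    then show ?thesis
      using value_b_min[OF p(1)] cost by simp
  qed
qed

lemma optimal_b:
  assumes "forward_feasible l pW (cap_I S) pF" "pW = max l1 (l - cap_I S - cap_F S)"
    and "value_b (l - cap_I S) (max l1 (l - cap_I S - cap_F S)) \<le> value_a l (min l l2) \<or>
      l2 \<le> l - cap_I S"
  shows "BL_solution_forward S M W l (pW, cap_I S, pF)"
proof (rule BL_solution_forwardI[OF assms(1)])
  have sum: "pW + pF = l - cap_I S" using assms(1) by (simp add: forward_feasible_def)
  have cost: "forward_cost pW (cap_I S) pF
      = value_b (l - cap_I S) (max l1 (l - cap_I S - cap_F S))"
    unfolding forward_cost_value_b sum assms(2)[symmetric] ..
  show "forward_cost pW (cap_I S) pF \<le> value_b (l - cap_I S) p"
    if "l - cap_I S - cap_F S \<le> p" for p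
    using value_b_min[OF that] cost by simp
  show "forward_cost pW (cap_I S) pF \<le> value_a l p"
    if p: "l - cap_I S \<le> p" "p \<le> l" for p
    using assms(3)
  proof
    assume "l2 \<le> l - cap_I S"
    then show ?thesis
      using value_a_mono[OF _ p(1), of l] value_a_eq_value_b[of "l - cap_I S"]
        value_b_min[of "l - cap_I S" "l - cap_I S"] cap_F_pos cost by simp
  next
    assume "value_b (l - cap_I S) (max l1 (l - cap_I S - cap_F S)) \<le> value_a l (min l l2)"
    then show ?thesis
      using value_a_min[OF p(2)] cost by simp
  qed
qed

lemma optimal_at_kink:
  assumes "forward_feasible l (l - cap_I S) (cap_I S) 0" "l2 \<le> l - cap_I S" "l - cap_I S \<le> l1"
  shows "BL_solution_forward S M W l (l - cap_I S, cap_I S, 0)"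
proof (rule BL_solution_forwardI[OF assms(1)])
  show "forward_cost (l - cap_I S) (cap_I S) 0 \<le> value_a l p" if "l - cap_I S \<le> p" for p
    using value_a_mono[OF assms(2) that] by (simp add: forward_cost_value_a)
  show "forward_cost (l - cap_I S) (cap_I S) 0 \<le> value_b (l - cap_I S) p"
    if "p \<le> l - cap_I S" for p
    using value_b_antimono[OF that assms(3)] by (simp add: forward_cost_value_b)
qed

text \<open>Ensures that the schedule \<open>l - cap_I S - cap_F S\<close> of the highest loads
  respects \<open>cap_W S\<close>.\<close>

lemma feasible_load_le:
  assumes "\<exists>x. BL_feasible S M W l x"
  shows "l - cap_I S - cap_F S \<le> cap_W S"
proof -
  obtain x where "BL_feasible S M W l x" using assms by blast
  from BL_feasible_forward[OF this] show ?thesis by (auto simp: forward_feasible_def)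
qed

section \<open>The dispatch rules\<close>

lemma solution_l2_le_l1:
  assumes "l2 \<le> l1" "0 \<le> l" "\<exists>x. BL_feasible S M W l x"
  shows "l \<le> l2 \<Longrightarrow> BL_solution_forward S M W l (l, 0, 0)"
    and "l2 \<le> l \<Longrightarrow> l \<le> cap_I S + l2 \<Longrightarrow> BL_solution_forward S M W l (l2, l - l2, 0)"
    and "cap_I S + l2 \<le> l \<Longrightarrow> l \<le> cap_I S + l1 \<Longrightarrow>
      BL_solution_forward S M W l (l - cap_I S, cap_I S, 0)"
    and "cap_I S + l1 \<le> l \<Longrightarrow> l \<le> cap_I S + cap_F S + l1 \<Longrightarrow>
      BL_solution_forward S M W l (l1, cap_I S, l - cap_I S - l1)"
    and "cap_I S + cap_F S + l1 \<le> l \<Longrightarrow>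
      BL_solution_forward S M W l (l - cap_I S - cap_F S, cap_I S, cap_F S)"
proof -
  note facts = assms(1,2) l1_nonneg l2_nonneg l1_le_cap_W l2_le_cap_W cap_I_pos cap_F_pos
    feasible_load_le[OF assms(3)]
  show "l \<le> l2 \<Longrightarrow> BL_solution_forward S M W l (l, 0, 0)"
    and "l2 \<le> l \<Longrightarrow> l \<le> cap_I S + l2 \<Longrightarrow> BL_solution_forward S M W l (l2, l - l2, 0)"
    by (rule optimal_a; use facts in \<open>simp add: forward_feasible_def\<close>)+
  show "cap_I S + l2 \<le> l \<Longrightarrow> l \<le> cap_I S + l1 \<Longrightarrow>
      BL_solution_forward S M W l (l - cap_I S, cap_I S, 0)"
    by (rule optimal_at_kink; use facts in \<open>simp add: forward_feasible_def\<close>)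
  show "cap_I S + l1 \<le> l \<Longrightarrow> l \<le> cap_I S + cap_F S + l1 \<Longrightarrow>
      BL_solution_forward S M W l (l1, cap_I S, l - cap_I S - l1)"
    and "cap_I S + cap_F S + l1 \<le> l \<Longrightarrow>
      BL_solution_forward S M W l (l - cap_I S - cap_F S, cap_I S, cap_F S)"
    by (rule optimal_b; use facts in \<open>simp add: forward_feasible_def\<close>)+
qed

text \<open>Any zero of \<open>gap\<close> serves as \<open>l8\<close>: monotonicity fixes the sign
  of \<open>gap\<close> on each side, even if the zeros fill an interval.\<close>

lemma solution_l1_less_l2:
  assumes "l1 < l2" "is_load_8 S F l8" "0 \<le> l" "\<exists>x. BL_feasible S M W l x"
  shows "l \<le> min l2 l8 \<Longrightarrow> BL_solution_forward S M W l (l, 0, 0)"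
    and "l2 \<le> l \<Longrightarrow> l \<le> l8 \<Longrightarrow> BL_solution_forward S M W l (l2, l - l2, 0)"
    and "l8 \<le> l \<Longrightarrow> l \<le> cap_I S + cap_F S + l1 \<Longrightarrow>
      BL_solution_forward S M W l (l1, cap_I S, l - cap_I S - l1)"
    and "max l8 (cap_I S + cap_F S + l1) \<le> l \<Longrightarrow>
      BL_solution_forward S M W l (l - cap_I S - cap_F S, cap_I S, cap_F S)"
proof -
  have l8: "l1 + cap_I S \<le> l8" "l8 \<le> l2 + cap_I S" "gap l8 = 0"
    using assms(2) by (auto simp: is_load_8_iff)
  \<comment> \<open>Monotonicity of \<open>gap\<close> holds between \<open>l1 + cap_I S\<close> and
    \<open>l2 + cap_I S\<close>; the second disjuncts here and in \<open>above\<close> cover the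
    loads outside.\<close>
  have below: "value_a l (min l l2) \<le> value_b (l - cap_I S) (max l1 (l - cap_I S - cap_F S)) \<or>
      l - cap_I S \<le> l1" if "l \<le> l8"
    using gap_antimono[of l l8] that l8 unfolding gap_def by linarith
  have above: "value_b (l - cap_I S) (max l1 (l - cap_I S - cap_F S)) \<le> value_a l (min l l2) \<or>
      l2 \<le> l - cap_I S" if "l8 \<le> l"
    using gap_antimono[of l8 l] that l8 unfolding gap_def by linarith
  note facts = assms(1,3) l1_nonneg l2_nonneg l1_le_cap_W l2_le_cap_W cap_I_pos cap_F_pos
    feasible_load_le[OF assms(4)] l8
  show "l \<le> min l2 l8 \<Longrightarrow> BL_solution_forward S M W l (l, 0, 0)"
    and "l2 \<le> l \<Longrightarrow> l \<le> l8 \<Longrightarrow> BL_solution_forward S M W l (l2, l - l2, 0)"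
    by (intro optimal_a below; use facts in \<open>simp add: forward_feasible_def\<close>)+
  show "l8 \<le> l \<Longrightarrow> l \<le> cap_I S + cap_F S + l1 \<Longrightarrow>
      BL_solution_forward S M W l (l1, cap_I S, l - cap_I S - l1)"
    and "max l8 (cap_I S + cap_F S + l1) \<le> l \<Longrightarrow>
      BL_solution_forward S M W l (l - cap_I S - cap_F S, cap_I S, cap_F S)"
    by (intro optimal_b above; use facts in \<open>simp add: forward_feasible_def\<close>)+
qed

end

theorem theorem3:
  fixes S :: power_system
    and M :: "'w measure"
    and W :: "'w \<Rightarrow> real"
    and f :: "real \<Rightarrow> ennreal"
    and F :: "real \<Rightarrow> real"
    and l1 l2 :: real
  assumes "prob_space M"
    and "distributed M lborel W f"
    and "\<And>\<omega>. \<omega> \<in> space M \<Longrightarrow> 0 \<le> W \<omega> \<and> W \<omega> \<le> cap_W S"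
    and "F = cdf (distr M borel W)"
    and "cap_I S > 0" and "cap_F S > 0" and "cap_W S > 0"
    and "c_I S > 0" and "c_F S > 0"
    and "voll S > c_F_up S" and "c_F_up S \<ge> c_F S" and "c_F S \<ge> c_F_dn S" and "c_F_dn S \<ge> 0"
    and "c_F_up S > c_F_dn S"
    and "c_I S < c_F S"
    and "l1 = load_1 S F" and "l2 = load_2 S F"
  shows
    "(l1 \<ge> l2 \<longrightarrow>
       (\<forall>l\<ge>0. (\<exists>x. BL_feasible S M W l x) \<longrightarrow>
         (0 \<le> l \<and> l \<le> l2 \<longrightarrow>
            BL_solution_forward S M W l (l, 0, 0)) \<and>
         (l2 \<le> l \<and> l \<le> cap_I S + l2 \<longrightarrow>
            BL_solution_forward S M W l (l2, l - l2, 0)) \<and>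
         (cap_I S + l2 \<le> l \<and> l \<le> cap_I S + l1 \<longrightarrow>
            BL_solution_forward S M W l (l - cap_I S, cap_I S, 0)) \<and>
         (cap_I S + l1 \<le> l \<and> l \<le> cap_I S + cap_F S + l1 \<longrightarrow>
            BL_solution_forward S M W l (l1, cap_I S, l - cap_I S - l1)) \<and>
         (cap_I S + cap_F S + l1 \<le> l \<longrightarrow>
            BL_solution_forward S M W l (l - cap_I S - cap_F S, cap_I S, cap_F S))))
     \<and>
     (l1 < l2 \<longrightarrow>
       (\<exists>l8. is_load_8 S F l8) \<and>
       (\<forall>l8. is_load_8 S F l8 \<longrightarrow>
         (\<forall>l\<ge>0. (\<exists>x. BL_feasible S M W l x) \<longrightarrow>
           (0 \<le> l \<and> l \<le> min l2 l8 \<longrightarrow>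
              BL_solution_forward S M W l (l, 0, 0)) \<and>
           (l2 \<le> l \<and> l \<le> l8 \<longrightarrow>
              BL_solution_forward S M W l (l2, l - l2, 0)) \<and>
           (l8 \<le> l \<and> l \<le> cap_I S + cap_F S + l1 \<longrightarrow>
              BL_solution_forward S M W l (l1, cap_I S, l - cap_I S - l1)) \<and>
           (max l8 (cap_I S + cap_F S + l1) \<le> l \<longrightarrow>
              BL_solution_forward S M W l (l - cap_I S - cap_F S, cap_I S, cap_F S)))))"
proof -
  interpret two_stage_market S M W f F l1 l2
    by (intro two_stage_market.intro two_stage_market_axioms.intro) (fact assms)+
  show ?thesis
  proof (intro conjI impI allI)
    show "\<exists>l8. is_load_8 S F l8" if "l1 < l2"
      using ex_gap_zero[OF that] by (simp add: is_load_8_iff)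
  qed (simp_all only: solution_l2_le_l1 solution_l1_less_l2)
qed

end
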